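(* Let $(X,\mu)$ be a uniform space. The following statements are satisfied: (1) $(X,\mu)$ is Bourbaki-complete if and only if $(X,s_f\mu)$ is complete. (2) $(X,\mu)$ is cofinally Bourbaki-complete if and only if $(X,s_f\mu)$ is cofinally complete. In particular, every uniform space with a base of star-finite covers for the uniformity satisfies that it is (cofinally) complete if and only if it is (cofinally) Bourbaki-complete.
   Context: Uniform spaces are Hausdorff and given by covers: $\mu$ is a family of covers of $X$ (the uniform covers), containing every cover refined by a member of $\mu$, and such that any two members of $\mu$ have a common star-refinement in $\mu$. For a cover $\mathcal U$ of $X$ and $A\subset X$: $St(A,\mathcal U)=\bigcup\{U\in\mathcal U: U\cap A\neq\emptyset\}$, $St^0(A,\mathcal U)=A$, $St^m(A,\mathcal U)=St(St^{m-1}(A,\mathcal U),\mathcal U)$ for $m\geq 1$. A filter $\mathcal F$ on $X$ is: Cauchy if for every $\mathcal U\in\mu$ there are $U\in\mathcal U$ and $F\in\mathcal F$ with $F\subset U$; cofinally Cauchy if for every $\mathcal U\in\mu$ there is $U\in\mathcal U$ with $F\cap U\neq\emptyset$ for all $F\in\mathcal F$; Bourbaki-Cauchy if for every $\mathcal U\in\mu$ there are $m\in\mathbb N$, $U\in\mathcal U$ and $F\in\mathcal F$ with $F\subset St^m(U,\mathcal U)$; cofinally Bourbaki-Cauchy if for every $\mathcal U\in\mu$ there are $m\in\mathbb N$ and $U\in\mathcal U$ with $F\cap St^m(U,\mathcal U)\neq\emptyset$ for all $F\in\mathcal F$. $(X,\mu)$ is complete (respectively cofinally complete, Bourbaki-complete,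 cofinally Bourbaki-complete) if every Cauchy (respectively cofinally Cauchy, Bourbaki-Cauchy, cofinally Bourbaki-Cauchy) filter has a cluster point in $X$. A cover is star-finite if each of its members meets at most finitely many of its members. $s_f\mu$ denotes the star-finite modification of $\mu$: the uniformity on $X$ (compatible with the topology of $X$) having as a base the family of all star-finite open covers belonging to $\mu$. *)

theory Defs
  imports "HOL-Analysis.Analysis"
begin

section \<open>Covering uniformities\<close>

definition cover_of :: "'a set \<Rightarrow> 'a set set \<Rightarrow> bool" where
  "cover_of X \<U> \<longleftrightarrow> \<Union>\<U> = X"

definition refines :: "'a set set \<Rightarrow> 'a set set \<Rightarrow> bool" where
  "refines \<V> \<U> \<longleftrightarrow> (\<forall>V\<in>\<V>. \<exists>U\<in>\<U>. V \<subseteq> U)"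

definition star :: "'a set \<Rightarrow> 'a set set \<Rightarrow> 'a set" where
  "star A \<U> = \<Union>{U \<in> \<U>. U \<inter> A \<noteq> {}}"

primrec star_iter :: "nat \<Rightarrow> 'a set \<Rightarrow> 'a set set \<Rightarrow> 'a set" where
  "star_iter 0 A \<U> = A"
| "star_iter (Suc m) A \<U> = star (star_iter m A \<U>) \<U>"

definition star_refines :: "'a set set \<Rightarrow> 'a set set \<Rightarrow> bool" where
  "star_refines \<V> \<U> \<longleftrightarrow> (\<forall>V\<in>\<V>. \<exists>U\<in>\<U>. star V \<V> \<subseteq> U)"

definition star_finite :: "'a set set \<Rightarrow> bool" where
  "star_finite \<U> \<longleftrightarrow> (\<forall>U\<in>\<U>. finite {V \<in> \<U>. U \<inter> V \<noteq> {}})"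

definition covering_uniformity :: "'a set \<Rightarrow> 'a set set set \<Rightarrow> bool" where
  "covering_uniformity X \<mu> \<longleftrightarrow>
     \<mu> \<noteq> {} \<and>
     (\<forall>\<U>\<in>\<mu>. cover_of X \<U>) \<and>
     (\<forall>\<U>\<in>\<mu>. \<forall>\<V>. cover_of X \<V> \<and> refines \<U> \<V> \<longrightarrow> \<V> \<in> \<mu>) \<and>
     (\<forall>\<U>\<in>\<mu>. \<forall>\<V>\<in>\<mu>. \<exists>\<W>\<in>\<mu>. star_refines \<W> \<U> \<and> star_refines \<W> \<V>)"

text \<open>The stars \<open>star {x} \<U>\<close> of a point with respect to uniform covers form a
  neighbourhood base at that point.\<close>

definition unif_topology :: "'a set \<Rightarrow> 'a set set set \<Rightarrow> 'a topology" where
  "unif_topology X \<mu> =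
     topology (\<lambda>G. G \<subseteq> X \<and> (\<forall>x\<in>G. \<exists>\<U>\<in>\<mu>. star {x} \<U> \<subseteq> G))"

definition hausdorff_uniform_space :: "'a set \<Rightarrow> 'a set set set \<Rightarrow> bool" where
  "hausdorff_uniform_space X \<mu> \<longleftrightarrow>
     covering_uniformity X \<mu> \<and> Hausdorff_space (unif_topology X \<mu>)"

definition uniformity_base :: "'a set set set \<Rightarrow> 'a set set set \<Rightarrow> bool" where
  "uniformity_base \<mu> \<B> \<longleftrightarrow> \<B> \<subseteq> \<mu> \<and> (\<forall>\<U>\<in>\<mu>. \<exists>\<V>\<in>\<B>. refines \<V> \<U>)"

text \<open>The uniformity generated by a base consists of the covers refined by a member of the base;
  here the base is the family of star-finite open members of \<open>\<mu>\<close>.\<close>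

definition star_finite_modification :: "'a set \<Rightarrow> 'a set set set \<Rightarrow> 'a set set set" where
  "star_finite_modification X \<mu> =
     {\<U>. cover_of X \<U> \<and>
        (\<exists>\<V>\<in>\<mu>. star_finite \<V> \<and> (\<forall>V\<in>\<V>. openin (unif_topology X \<mu>) V) \<and> refines \<V> \<U>)}"

section \<open>Filters and completeness\<close>

text \<open>The library's filters may be improper and live on the whole type; a filter on \<open>X\<close> in
  the usual sense is a proper one that contains \<open>X\<close>.\<close>

definition filter_on :: "'a set \<Rightarrow> 'a filter \<Rightarrow> bool" where
  "filter_on X F \<longleftrightarrow> F \<noteq> bot \<and> F \<le> principal X"

definition filter_sets :: "'a filter \<Rightarrow> 'a set set" where
  "filter_sets F = {S. eventually (\<lambda>x. x \<in> S) F}"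

definition cluster_point :: "'a topology \<Rightarrow> 'a filter \<Rightarrow> 'a \<Rightarrow> bool" where
  "cluster_point T F x \<longleftrightarrow> x \<in> topspace T \<and> (\<forall>S\<in>filter_sets F. x \<in> T closure_of S)"

definition cauchy_filter_wrt :: "'a set set set \<Rightarrow> 'a filter \<Rightarrow> bool" where
  "cauchy_filter_wrt \<mu> F \<longleftrightarrow> (\<forall>\<U>\<in>\<mu>. \<exists>U\<in>\<U>. \<exists>S\<in>filter_sets F. S \<subseteq> U)"

definition cofinally_cauchy_filter :: "'a set set set \<Rightarrow> 'a filter \<Rightarrow> bool" where
  "cofinally_cauchy_filter \<mu> F \<longleftrightarrow> (\<forall>\<U>\<in>\<mu>. \<exists>U\<in>\<U>. \<forall>S\<in>filter_sets F. S \<inter> U \<noteq> {})"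

definition bourbaki_cauchy_filter :: "'a set set set \<Rightarrow> 'a filter \<Rightarrow> bool" where
  "bourbaki_cauchy_filter \<mu> F \<longleftrightarrow>
     (\<forall>\<U>\<in>\<mu>. \<exists>m. \<exists>U\<in>\<U>. \<exists>S\<in>filter_sets F. S \<subseteq> star_iter m U \<U>)"

definition cofinally_bourbaki_cauchy_filter :: "'a set set set \<Rightarrow> 'a filter \<Rightarrow> bool" where
  "cofinally_bourbaki_cauchy_filter \<mu> F \<longleftrightarrow>
     (\<forall>\<U>\<in>\<mu>. \<exists>m. \<exists>U\<in>\<U>. \<forall>S\<in>filter_sets F. S \<inter> star_iter m U \<U> \<noteq> {})"

definition complete_unif :: "'a set \<Rightarrow> 'a set set set \<Rightarrow> bool" where
  "complete_unif X \<mu> \<longleftrightarrow>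
     (\<forall>F. filter_on X F \<and> cauchy_filter_wrt \<mu> F \<longrightarrow> (\<exists>x. cluster_point (unif_topology X \<mu>) F x))"

definition cofinally_complete_unif :: "'a set \<Rightarrow> 'a set set set \<Rightarrow> bool" where
  "cofinally_complete_unif X \<mu> \<longleftrightarrow>
     (\<forall>F. filter_on X F \<and> cofinally_cauchy_filter \<mu> F
          \<longrightarrow> (\<exists>x. cluster_point (unif_topology X \<mu>) F x))"

definition bourbaki_complete_unif :: "'a set \<Rightarrow> 'a set set set \<Rightarrow> bool" where
  "bourbaki_complete_unif X \<mu> \<longleftrightarrow>
     (\<forall>F. filter_on X F \<and> bourbaki_cauchy_filter \<mu> F
          \<longrightarrow> (\<exists>x. cluster_point (unif_topology X \<mu>) F x))"

definition cofinally_bourbaki_complete_unif :: "'a set \<Rightarrow> 'a set set set \<Rightarrow> bool" where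
  "cofinally_bourbaki_complete_unif X \<mu> \<longleftrightarrow>
     (\<forall>F. filter_on X F \<and> cofinally_bourbaki_cauchy_filter \<mu> F
          \<longrightarrow> (\<exists>x. cluster_point (unif_topology X \<mu>) F x))"

section \<open>The induced topologies are well defined\<close>

text \<open>\<^const>\<open>unif_topology\<close> applies \<^const>\<open>topology\<close> to a predicate, which is meaningful only if that
  predicate is a topology. This holds as soon as any two covers have a common refinement, hence
  both for a covering uniformity and for its star-finite modification.\<close>

lemma refines_star_mono:
  assumes "refines \<W> \<U>" shows "star {x} \<W> \<subseteq> \<Union>{U \<in> \<U>. x \<in> U}"
  using assms unfolding refines_def star_def by fast

lemma openin_unif_topology_aux:
  assumes ne: "\<mu> \<noteq> {}" and cov: "\<And>\<U>. \<U> \<in> \<mu> \<Longrightarrow> cover_of X \<U>"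
    and ref: "\<And>\<U> \<V>. \<U> \<in> \<mu> \<Longrightarrow> \<V> \<in> \<mu> \<Longrightarrow> \<exists>\<W>\<in>\<mu>. refines \<W> \<U> \<and> refines \<W> \<V>"
  shows "openin (unif_topology X \<mu>) G \<longleftrightarrow> G \<subseteq> X \<and> (\<forall>x\<in>G. \<exists>\<U>\<in>\<mu>. star {x} \<U> \<subseteq> G)"
    and "topspace (unif_topology X \<mu>) = X"
proof -
  let ?P = "\<lambda>G. G \<subseteq> X \<and> (\<forall>x\<in>G. \<exists>\<U>\<in>\<mu>. star {x} \<U> \<subseteq> G)"
  have mono: "star {x} \<W> \<subseteq> star {x} \<U>" if "refines \<W> \<U>" for x \<W> \<U>
    using refines_star_mono[OF that] unfolding star_def by blast
  have int: "?P (S \<inter> T)" if S: "?P S" and T: "?P T" for S T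
  proof (intro conjI ballI)
    show "S \<inter> T \<subseteq> X" using S by blast
    fix x assume "x \<in> S \<inter> T"
    then obtain \<U> \<V> where uv: "\<U> \<in> \<mu>" "\<V> \<in> \<mu>" "star {x} \<U> \<subseteq> S" "star {x} \<V> \<subseteq> T"
      using S T by blast
    obtain \<W> where "\<W> \<in> \<mu>" "refines \<W> \<U>" "refines \<W> \<V>" using ref uv by blast
    then show "\<exists>\<W>\<in>\<mu>. star {x} \<W> \<subseteq> S \<inter> T"
      using mono uv by (meson Int_greatest order_trans)
  qed
  have un: "?P (\<Union>\<K>)" if "\<forall>K\<in>\<K>. ?P K" for \<K>
    using that by (meson UnionE Union_least Union_upper order_trans)
  have "istopology ?P" unfolding istopology_def using int un by blast
  then have op: "openin (unif_topology X \<mu>) = ?P"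
    unfolding unif_topology_def by (simp add: topology_inverse')
  then show "openin (unif_topology X \<mu>) G \<longleftrightarrow> ?P G" by simp
  have "?P X" using ne cov unfolding cover_of_def star_def by blast
  then show "topspace (unif_topology X \<mu>) = X" unfolding topspace_def op by blast
qed

lemma covering_uniformity_common_refinement:
  assumes "covering_uniformity X \<mu>" "\<U> \<in> \<mu>" "\<V> \<in> \<mu>"
  shows "\<exists>\<W>\<in>\<mu>. refines \<W> \<U> \<and> refines \<W> \<V>"
proof -
  obtain \<W> where "\<W> \<in> \<mu>" and s: "star_refines \<W> \<U>" "star_refines \<W> \<V>"
    using assms unfolding covering_uniformity_def by blast
  moreover have "refines \<W> \<U>" if "star_refines \<W> \<U>" for \<U>
  proof -
    have "W \<subseteq> star W \<W>" if "W \<in> \<W>" for W using that unfolding star_def by auto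
    then show ?thesis
      using \<open>star_refines \<W> \<U>\<close> unfolding star_refines_def refines_def by (meson order_trans)
  qed
  ultimately show ?thesis by blast
qed

lemma openin_unif_topology:
  assumes "covering_uniformity X \<mu>"
  shows "openin (unif_topology X \<mu>) G \<longleftrightarrow> G \<subseteq> X \<and> (\<forall>x\<in>G. \<exists>\<U>\<in>\<mu>. star {x} \<U> \<subseteq> G)"
    and "topspace (unif_topology X \<mu>) = X"
proof -
  have ne: "\<mu> \<noteq> {}" and cov: "\<And>\<U>. \<U> \<in> \<mu> \<Longrightarrow> cover_of X \<U>"
    using assms unfolding covering_uniformity_def by auto
  note * = openin_unif_topology_aux[OF ne cov covering_uniformity_common_refinement[OF assms]]
  show "openin (unif_topology X \<mu>) G \<longleftrightarrow> G \<subseteq> X \<and> (\<forall>x\<in>G. \<exists>\<U>\<in>\<mu>. star {x} \<U> \<subseteq> G)"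
    by (rule *(1))
  show "topspace (unif_topology X \<mu>) = X" by (rule *(2))
qed

lemma openin_star_finite_modification:
  assumes \<mu>: "covering_uniformity X \<mu>"
  defines "\<nu> \<equiv> star_finite_modification X \<mu>"
  shows "openin (unif_topology X \<nu>) G \<longleftrightarrow> G \<subseteq> X \<and> (\<forall>x\<in>G. \<exists>\<U>\<in>\<nu>. star {x} \<U> \<subseteq> G)"
    and "topspace (unif_topology X \<nu>) = X"
proof -
  let ?B = "\<lambda>\<V>. \<V> \<in> \<mu> \<and> star_finite \<V> \<and> (\<forall>V\<in>\<V>. openin (unif_topology X \<mu>) V)"
  have cov: "cover_of X \<U>" if "\<U> \<in> \<mu>" for \<U>
    using \<mu> that unfolding covering_uniformity_def by blast
  have up: "\<V> \<in> \<mu>" if "\<U> \<in> \<mu>" "cover_of X \<V>" "refines \<U> \<V>" for \<U> \<V>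
    using \<mu> that unfolding covering_uniformity_def by blast
  obtain \<U>0 where \<U>0: "\<U>0 \<in> \<mu>" using \<mu> unfolding covering_uniformity_def by blast
  have "cover_of X {X}" "refines \<U>0 {X}"
    using cov[OF \<U>0] unfolding cover_of_def refines_def by auto
  then have "{X} \<in> \<mu>" using up[OF \<U>0] by blast
  moreover have "openin (unif_topology X \<mu>) X"
    using openin_topspace openin_unif_topology(2)[OF \<mu>] by metis
  moreover have "star_finite {X}" unfolding star_finite_def by auto
  moreover have "refines {X} {X}" unfolding refines_def by blast
  ultimately have "{X} \<in> \<nu>"
    using \<open>cover_of X {X}\<close> unfolding \<nu>_def star_finite_modification_def by auto
  then have ne: "\<nu> \<noteq> {}" by blast
  have meet: "\<exists>\<W>. ?B \<W> \<and> refines \<W> \<U> \<and> refines \<W> \<V>" if U: "?B \<U>" and V: "?B \<V>" for \<U> \<V>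
  proof -
    define \<W> where "\<W> = (\<lambda>(U, V). U \<inter> V) ` (\<U> \<times> \<V>)"
    have r: "refines \<W> \<U>" "refines \<W> \<V>" unfolding \<W>_def refines_def by auto
    obtain \<Z> where \<Z>: "\<Z> \<in> \<mu>" "refines \<Z> \<U>" "refines \<Z> \<V>"
      using covering_uniformity_common_refinement[OF \<mu>] U V by blast
    have "refines \<Z> \<W>" unfolding refines_def
    proof
      fix Z assume "Z \<in> \<Z>"
      obtain U where "U \<in> \<U>" "Z \<subseteq> U"
        using \<Z>(2) \<open>Z \<in> \<Z>\<close> unfolding refines_def by blast
      moreover obtain V where "V \<in> \<V>" "Z \<subseteq> V"
        using \<Z>(3) \<open>Z \<in> \<Z>\<close> unfolding refines_def by blast
      ultimately have "U \<inter> V \<in> \<W>" "Z \<subseteq> U \<inter> V" unfolding \<W>_def by auto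
      then show "\<exists>W\<in>\<W>. Z \<subseteq> W" by blast
    qed
    moreover have "cover_of X \<W>"
    proof -
      have "\<Union>\<W> = \<Union>\<U> \<inter> \<Union>\<V>" unfolding \<W>_def by blast
      then show ?thesis using cov[of \<U>] cov[of \<V>] U V unfolding cover_of_def by simp
    qed
    ultimately have "\<W> \<in> \<mu>" using up \<Z> by blast
    moreover have "star_finite \<W>" unfolding star_finite_def
    proof
      fix W assume "W \<in> \<W>"
      then obtain U V where W: "U \<in> \<U>" "V \<in> \<V>" "W = U \<inter> V" unfolding \<W>_def by auto
      have "{W' \<in> \<W>. W \<inter> W' \<noteq> {}} \<subseteq>
            (\<lambda>(U, V). U \<inter> V) ` ({U' \<in> \<U>. U \<inter> U' \<noteq> {}} \<times> {V' \<in> \<V>. V \<inter> V' \<noteq> {}})"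
        unfolding \<W>_def W(3) by auto
      moreover have "finite {U' \<in> \<U>. U \<inter> U' \<noteq> {}}" "finite {V' \<in> \<V>. V \<inter> V' \<noteq> {}}"
        using U V W unfolding star_finite_def by blast+
      ultimately show "finite {W' \<in> \<W>. W \<inter> W' \<noteq> {}}"
        by (meson finite_SigmaI finite_imageI finite_subset)
    qed
    moreover have "\<forall>W\<in>\<W>. openin (unif_topology X \<mu>) W" using U V unfolding \<W>_def by auto
    ultimately show ?thesis using r by blast
  qed
  have trans: "refines \<W> \<U>" if "refines \<W> \<V>" "refines \<V> \<U>" for \<U> \<V> \<W> :: "'a set set"
    using that unfolding refines_def by (meson order_trans)
  have in_\<nu>: "\<U> \<in> \<nu> \<longleftrightarrow> cover_of X \<U> \<and> (\<exists>\<V>. ?B \<V> \<and> refines \<V> \<U>)" for \<U>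
    unfolding \<nu>_def star_finite_modification_def by blast
  have base: "\<W> \<in> \<nu>" if "?B \<W>" for \<W>
  proof -
    have "refines \<W> \<W>" unfolding refines_def by blast
    then show ?thesis using that cov[of \<W>] in_\<nu>[of \<W>] by blast
  qed
  have ref: "\<exists>\<W>\<in>\<nu>. refines \<W> \<U> \<and> refines \<W> \<V>" if "\<U> \<in> \<nu>" "\<V> \<in> \<nu>" for \<U> \<V>
  proof -
    obtain \<U>' \<V>' where "?B \<U>'" "refines \<U>' \<U>" "?B \<V>'" "refines \<V>' \<V>"
      using \<open>\<U> \<in> \<nu>\<close> \<open>\<V> \<in> \<nu>\<close> unfolding in_\<nu> by blast
    then obtain \<W> where "?B \<W>" "refines \<W> \<U>'" "refines \<W> \<V>'"
      using meet[of \<U>' \<V>'] by blast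
    then have "\<W> \<in> \<nu>" "refines \<W> \<U>" "refines \<W> \<V>"
      using base[of \<W>] trans[OF _ \<open>refines \<U>' \<U>\<close>] trans[OF _ \<open>refines \<V>' \<V>\<close>] by blast+
    then show ?thesis by blast
  qed
  have cov\<nu>: "cover_of X \<U>" if "\<U> \<in> \<nu>" for \<U>
    using that in_\<nu> by blast
  note * = openin_unif_topology_aux[OF ne cov\<nu> ref]
  show "openin (unif_topology X \<nu>) G \<longleftrightarrow> G \<subseteq> X \<and> (\<forall>x\<in>G. \<exists>\<U>\<in>\<nu>. star {x} \<U> \<subseteq> G)"
    by (rule *(1))
  show "topspace (unif_topology X \<nu>) = X" by (rule *(2))
qed

end

theory Submission
  imports Defs
begin

text \<open>
  Write \<open>\<nu>\<close> for the star-finite modification of \<open>\<mu>\<close>. Replacing the members of a star-finite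
  uniform cover by their interiors gives a star-finite open uniform cover, so \<open>\<nu>\<close> contains every
  star-finite member of \<open>\<mu>\<close>; in particular \<open>\<nu> = \<mu>\<close> when \<open>\<mu>\<close> has a base of star-finite covers, and
  the last claim follows from the first two. Moreover \<open>\<mu>\<close> and \<open>\<nu>\<close> have the same topology, because
  points are closed and the two-element cover \<open>{G, X - {x}}\<close> is uniform for every open \<open>G\<close>
  containing \<open>x\<close>. Hence the two uniformities have the same cluster points.

  It remains to compare the filters. In a star-finite cover \<open>\<W>\<close> each set \<open>star_iter m W \<W>\<close> with
  \<open>W \<in> \<W>\<close> is contained in a finite union of members of \<open>\<W>\<close>. Therefore a cofinally Bourbaki-Cauchy
  filter of \<open>\<mu>\<close> is cofinally Cauchy for \<open>\<nu>\<close>, and a Bourbaki-Cauchy ultrafilter of \<open>\<mu>\<close> is Cauchy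
  for \<open>\<nu>\<close>; an arbitrary Bourbaki-Cauchy filter is contained in such an ultrafilter, whose cluster
  points are also cluster points of the filter.

  Conversely, given a uniform cover \<open>\<U>\<close>, choose a base point in each class of the relation of being
  joined by a finite chain of members of \<open>\<U>\<close>, and call the least length of a chain from the base
  point to \<open>x\<close> the level of \<open>x\<close>. The levels of two points of the same member of \<open>\<U>\<close> differ by at
  most one, so \<open>\<U>\<close> refines the cover consisting of the pairs of consecutive levels of the
  classes. This cover is star-finite, and its nonempty members lie in sets \<open>star_iter m U \<U>\<close>
  (lemma \<open>star_finite_level_cover\<close>). Consequently (cofinally) Cauchy filters of \<open>\<nu>\<close> are (cofinally)
  Bourbaki-Cauchy for \<open>\<mu>\<close>.
\<close>

section \<open>Uniform covers and the star-finite modification\<close>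

lemma covering_uniformityD:
  assumes \<mu>: "covering_uniformity X \<mu>" and \<U>: "\<U> \<in> \<mu>"
  shows covering_uniformity_cover: "\<Union>\<U> = X"
    and covering_uniformity_coarser:
      "\<Union>\<V> = X \<Longrightarrow> (\<And>U. U \<in> \<U> \<Longrightarrow> \<exists>V\<in>\<V>. U \<subseteq> V) \<Longrightarrow> \<V> \<in> \<mu>"
    and covering_uniformity_star_refinement: "\<exists>\<W>\<in>\<mu>. star_refines \<W> \<U>"
proof -
  note ax = \<mu>[unfolded covering_uniformity_def, THEN conjunct2]
  have cov: "\<forall>\<U>\<in>\<mu>. cover_of X \<U>" by (rule ax[THEN conjunct1])
  have up: "\<forall>\<U>\<in>\<mu>. \<forall>\<V>. cover_of X \<V> \<and> refines \<U> \<V> \<longrightarrow> \<V> \<in> \<mu>"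
    by (rule ax[THEN conjunct2, THEN conjunct1])
  have star: "\<forall>\<U>\<in>\<mu>. \<forall>\<V>\<in>\<mu>. \<exists>\<W>\<in>\<mu>. star_refines \<W> \<U> \<and> star_refines \<W> \<V>"
    by (rule ax[THEN conjunct2, THEN conjunct2])
  show "\<Union>\<U> = X" using cov \<U> unfolding cover_of_def by simp
  show "\<exists>\<W>\<in>\<mu>. star_refines \<W> \<U>" using star \<U> by blast
  show "\<V> \<in> \<mu>" if "\<Union>\<V> = X" "\<And>U. U \<in> \<U> \<Longrightarrow> \<exists>V\<in>\<V>. U \<subseteq> V"
  proof -
    have "cover_of X \<V> \<and> refines \<U> \<V>" using that unfolding cover_of_def refines_def by blast
    then show ?thesis by (rule up[rule_format, OF \<U>])
  qed
qed

lemma subset_interior_of_if_star_subset: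
  assumes \<mu>: "covering_uniformity X \<mu>" and \<V>: "\<V> \<in> \<mu>"
    and A: "A \<subseteq> X" "star A \<V> \<subseteq> W"
  shows "A \<subseteq> unif_topology X \<mu> interior_of W"
proof -
  let ?T = "unif_topology X \<mu>"
  \<comment> \<open>The set of points having a uniform neighbourhood inside \<open>W\<close> is open, by star refinement.\<close>
  define G where "G = {x \<in> X. \<exists>\<Z>\<in>\<mu>. star {x} \<Z> \<subseteq> W}"
  have "openin ?T G"
    unfolding openin_unif_topology(1)[OF \<mu>]
  proof (intro conjI ballI)
    show "G \<subseteq> X" unfolding G_def by blast
    fix x assume "x \<in> G"
    then obtain \<Z> where \<Z>: "\<Z> \<in> \<mu>" "star {x} \<Z> \<subseteq> W" unfolding G_def by blast
    obtain \<Y> where \<Y>: "\<Y> \<in> \<mu>" "star_refines \<Y> \<Z>"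
      using covering_uniformity_star_refinement[OF \<mu> \<Z>(1)] by blast
    have "y \<in> G" if y: "y \<in> star {x} \<Y>" for y
    proof -
      obtain Y where Y: "Y \<in> \<Y>" "x \<in> Y" "y \<in> Y" using y unfolding star_def by auto
      obtain Z where Z: "Z \<in> \<Z>" "star Y \<Y> \<subseteq> Z"
        using \<Y>(2) Y(1) unfolding star_refines_def by blast
      have "star {y} \<Y> \<subseteq> star Y \<Y>" using Y unfolding star_def by blast
      moreover have "x \<in> Z" using Y Z unfolding star_def by blast
      then have "Z \<subseteq> W" using \<Z>(2) Z(1) unfolding star_def by blast
      moreover have "y \<in> X" using covering_uniformity_cover[OF \<mu> \<Y>(1)] Y by blast
      ultimately show ?thesis using Z(2) \<Y>(1) unfolding G_def by blast
    qed
    then show "\<exists>\<U>\<in>\<mu>. star {x} \<U> \<subseteq> G" using \<Y>(1) by blast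
  qed
  moreover have "G \<subseteq> W"
  proof
    fix x assume "x \<in> G"
    then obtain \<Z> where "\<Z> \<in> \<mu>" "star {x} \<Z> \<subseteq> W" "x \<in> X" unfolding G_def by blast
    then show "x \<in> W"
      using covering_uniformity_cover[OF \<mu>, of \<Z>] unfolding star_def by blast
  qed
  moreover have "A \<subseteq> G"
  proof
    fix x assume "x \<in> A"
    then have "star {x} \<V> \<subseteq> W" "x \<in> X" using A unfolding star_def by blast+
    then show "x \<in> G" using \<V> unfolding G_def by blast
  qed
  ultimately show ?thesis by (meson interior_of_maximal order_trans)
qed

text \<open>Openness may be dropped from the description of the star-finite modification: the interiors
  of the members of a star-finite uniform cover still form a uniform cover, refined by any star
  refinement of the original one.\<close>

lemma star_finite_modification_iff:
  assumes \<mu>: "covering_uniformity X \<mu>"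
  shows "\<U> \<in> star_finite_modification X \<mu> \<longleftrightarrow>
    \<U> \<in> \<mu> \<and> (\<exists>\<W>\<in>\<mu>. star_finite \<W> \<and> refines \<W> \<U>)"
proof
  assume "\<U> \<in> star_finite_modification X \<mu>"
  then show "\<U> \<in> \<mu> \<and> (\<exists>\<W>\<in>\<mu>. star_finite \<W> \<and> refines \<W> \<U>)"
    using \<mu> unfolding star_finite_modification_def covering_uniformity_def by blast
next
  let ?T = "unif_topology X \<mu>"
  assume "\<U> \<in> \<mu> \<and> (\<exists>\<W>\<in>\<mu>. star_finite \<W> \<and> refines \<W> \<U>)"
  then obtain \<W> where \<U>: "\<U> \<in> \<mu>" and \<W>: "\<W> \<in> \<mu>" "star_finite \<W>" "refines \<W> \<U>" by blast
  obtain \<V> where \<V>: "\<V> \<in> \<mu>" "star_refines \<V> \<W>"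
    using covering_uniformity_star_refinement[OF \<mu> \<W>(1)] by blast
  have cov\<V>: "\<Union>\<V> = X" by (rule covering_uniformity_cover[OF \<mu> \<V>(1)])
  define \<I> where "\<I> = (\<lambda>W. ?T interior_of W) ` \<W>"
  have \<V>\<I>: "\<exists>I\<in>\<I>. V \<subseteq> I" if V: "V \<in> \<V>" for V
  proof -
    obtain W where W: "W \<in> \<W>" "star V \<V> \<subseteq> W"
      using \<V>(2) V unfolding star_refines_def by blast
    have "V \<subseteq> X" using V cov\<V> by blast
    then have "V \<subseteq> ?T interior_of W"
      using subset_interior_of_if_star_subset[OF \<mu> \<V>(1)] W(2) by blast
    then show ?thesis using W(1) unfolding \<I>_def by blast
  qed
  have sub: "?T interior_of W \<subseteq> W" for W by (rule interior_of_subset)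
  have "\<Union>\<I> \<subseteq> \<Union>\<W>" unfolding \<I>_def using sub by blast
  moreover have "\<Union>\<V> \<subseteq> \<Union>\<I>" using \<V>\<I> by blast
  ultimately have "\<Union>\<I> = X" using cov\<V> covering_uniformity_cover[OF \<mu> \<W>(1)] by auto
  then have "\<I> \<in> \<mu>" using covering_uniformity_coarser[OF \<mu> \<V>(1)] \<V>\<I> by blast
  moreover have "star_finite \<I>" unfolding star_finite_def
  proof
    fix I assume "I \<in> \<I>"
    then obtain W where W: "W \<in> \<W>" "I = ?T interior_of W" unfolding \<I>_def by blast
    have "{J \<in> \<I>. I \<inter> J \<noteq> {}} \<subseteq> (\<lambda>W. ?T interior_of W) ` {W' \<in> \<W>. W \<inter> W' \<noteq> {}}"
      unfolding \<I>_def W(2) using sub by blast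
    then show "finite {J \<in> \<I>. I \<inter> J \<noteq> {}}"
      using \<W>(2) W(1) unfolding star_finite_def by (meson finite_imageI finite_subset)
  qed
  moreover have "\<forall>I\<in>\<I>. openin ?T I" unfolding \<I>_def by auto
  moreover have "refines \<I> \<U>"
    using \<W>(3) sub unfolding \<I>_def refines_def by (metis (no_types, lifting) imageE order_trans)
  ultimately show "\<U> \<in> star_finite_modification X \<mu>"
    using covering_uniformity_cover[OF \<mu> \<U>]
    unfolding star_finite_modification_def cover_of_def by blast
qed

lemma star_finite_modification_eq:
  assumes \<mu>: "covering_uniformity X \<mu>"
    and \<B>: "uniformity_base \<mu> \<B>" "\<forall>\<U>\<in>\<B>. star_finite \<U>"
  shows "star_finite_modification X \<mu> = \<mu>"
proof (rule set_eqI)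
  fix \<U>
  have "\<exists>\<W>\<in>\<mu>. star_finite \<W> \<and> refines \<W> \<U>" if \<U>: "\<U> \<in> \<mu>"
  proof -
    obtain \<W> where \<W>: "\<W> \<in> \<B>" "refines \<W> \<U>"
      using \<B>(1) \<U> unfolding uniformity_base_def by meson
    moreover have "\<W> \<in> \<mu>" using \<B>(1) \<W>(1) unfolding uniformity_base_def by (meson subsetD)
    ultimately show ?thesis using \<B>(2) by meson
  qed
  then show "\<U> \<in> star_finite_modification X \<mu> \<longleftrightarrow> \<U> \<in> \<mu>"
    using star_finite_modification_iff[OF \<mu>, of \<U>] by meson
qed

lemma unif_topology_star_finite_modification:
  assumes "hausdorff_uniform_space X \<mu>"
  shows "unif_topology X (star_finite_modification X \<mu>) = unif_topology X \<mu>"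
proof -
  let ?T = "unif_topology X \<mu>" and ?\<nu> = "star_finite_modification X \<mu>"
  have \<mu>: "covering_uniformity X \<mu>" and haus: "Hausdorff_space ?T"
    using assms unfolding hausdorff_uniform_space_def by auto
  have "openin (unif_topology X ?\<nu>) G \<longleftrightarrow> openin ?T G" for G
  proof
    assume "openin (unif_topology X ?\<nu>) G"
    then show "openin ?T G"
      unfolding openin_unif_topology(1)[OF \<mu>] openin_star_finite_modification(1)[OF \<mu>]
      using star_finite_modification_iff[OF \<mu>] by blast
  next
    assume G: "openin ?T G"
    show "openin (unif_topology X ?\<nu>) G"
      unfolding openin_star_finite_modification(1)[OF \<mu>]
    proof (intro conjI ballI)
      show GX: "G \<subseteq> X" using G openin_unif_topology(1)[OF \<mu>] by blast
      fix x assume x: "x \<in> G"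
      obtain \<U> where \<U>: "\<U> \<in> \<mu>" "star {x} \<U> \<subseteq> G"
        using G x openin_unif_topology(1)[OF \<mu>] by blast
      let ?\<V> = "{G, X - {x}}"
      have "closedin ?T {x}"
        using closedin_Hausdorff_singleton[OF haus] x GX openin_unif_topology(2)[OF \<mu>] by blast
      then have op: "openin ?T (X - {x})"
        using openin_unif_topology(2)[OF \<mu>] unfolding closedin_def by auto
      have cov: "\<Union>?\<V> = X" using x GX by blast
      have "\<exists>V\<in>?\<V>. U \<subseteq> V" if "U \<in> \<U>" for U
        using \<U>(2) that covering_uniformity_cover[OF \<mu> \<U>(1)] unfolding star_def by fastforce
      then have "?\<V> \<in> \<mu>" using covering_uniformity_coarser[OF \<mu> \<U>(1) cov] by blast
      moreover have "star_finite ?\<V>" unfolding star_finite_def by simp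
      moreover have "refines ?\<V> ?\<V>" unfolding refines_def by blast
      ultimately have "?\<V> \<in> ?\<nu>"
        using star_finite_modification_iff[OF \<mu>] by blast
      moreover have "star {x} ?\<V> \<subseteq> G" unfolding star_def by auto
      ultimately show "\<exists>\<U>\<in>?\<nu>. star {x} \<U> \<subseteq> G" by blast
    qed
  qed
  then show ?thesis by (simp add: topology_eq)
qed

section \<open>Iterated stars\<close>

lemma star_iter_star_finite:
  assumes \<W>: "star_finite \<W>" and U: "U \<in> \<W>"
  shows "\<exists>\<F>. finite \<F> \<and> \<F> \<subseteq> \<W> \<and> star_iter m U \<W> \<subseteq> \<Union>\<F>"
proof (induction m)
  case 0
  show ?case using U by (intro exI[of _ "{U}"]) auto
next
  case (Suc m)
  then obtain \<F> where \<F>: "finite \<F>" "\<F> \<subseteq> \<W>" "star_iter m U \<W> \<subseteq> \<Union>\<F>" by blast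
  let ?\<G> = "\<Union>F\<in>\<F>. {V \<in> \<W>. F \<inter> V \<noteq> {}}"
  have "finite ?\<G>" using \<F>(1,2) \<W> unfolding star_finite_def by blast
  moreover have "star_iter (Suc m) U \<W> \<subseteq> \<Union>?\<G>"
    using \<F>(3) unfolding star_iter.simps star_def by blast
  ultimately show ?case by blast
qed

text \<open>Two points are \<open>\<U>\<close>-close if some member of \<open>\<U>\<close> contains both; chains of members of \<open>\<U>\<close>
  correspond to powers of this relation.\<close>

definition close_rel :: "'a set set \<Rightarrow> ('a \<times> 'a) set" where
  "close_rel \<U> = {(x, y). \<exists>U\<in>\<U>. x \<in> U \<and> y \<in> U}"

lemma star_iter_eq_Image: "star_iter m A \<U> = (close_rel \<U> ^^ m) `` A"
proof (induction m)
  case (Suc m)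
  have "star B \<U> = close_rel \<U> `` B" for B unfolding star_def close_rel_def by blast
  then show ?case using Suc by auto
qed simp

lemma star_iter_mono: "A \<subseteq> B \<Longrightarrow> star_iter m A \<U> \<subseteq> star_iter m B \<U>"
  unfolding star_iter_eq_Image by blast

lemma star_iter_le_Suc:
  assumes "A \<subseteq> \<Union>\<U>"
  shows "star_iter m A \<U> \<subseteq> star_iter (Suc m) A \<U>"
proof -
  have "A \<subseteq> star A \<U>" using assms unfolding star_def by blast
  moreover have "star_iter (Suc m) A \<U> = star_iter m (star A \<U>) \<U>"
    by (induction m) simp_all
  ultimately show ?thesis using star_iter_mono by metis
qed

text \<open>The members of the cover are the unions of two consecutive levels, taken in one chain class
  of \<open>\<U>\<close>.\<close>

lemma star_finite_level_cover:
  fixes \<U> :: "'a set set"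
  shows "\<exists>\<W>. \<Union>\<W> = \<Union>\<U> \<and> star_finite \<W> \<and> refines \<U> \<W> \<and>
    (\<forall>A\<in>\<W>. A \<noteq> {} \<longrightarrow> (\<exists>m. \<exists>U\<in>\<U>. A \<subseteq> star_iter m U \<U>))"
proof -
  let ?R = "close_rel \<U>"
  define base where "base x = (SOME c. (c, x) \<in> ?R\<^sup>*)" for x
  define level where "level x = (LEAST m. (base x, x) \<in> ?R ^^ m)" for x
  have "sym (?R\<^sup>*)" by (rule sym_rtrancl) (auto simp: close_rel_def sym_def)
  then have base_eq: "base x = base y" if "(x, y) \<in> ?R" for x y
  proof -
    have "(c, x) \<in> ?R\<^sup>* \<longleftrightarrow> (c, y) \<in> ?R\<^sup>*" for c
      using that \<open>sym (?R\<^sup>*)\<close> by (meson r_into_rtrancl rtrancl_trans symE)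
    then show ?thesis unfolding base_def by simp
  qed
  have base: "(base x, x) \<in> ?R\<^sup>*" for x unfolding base_def by (rule someI[of _ x]) simp
  then have level: "(base x, x) \<in> ?R ^^ level x" for x
    unfolding level_def by (meson LeastI_ex rtrancl_imp_relpow)
  have level_le: "level y \<le> Suc (level x)" if "(x, y) \<in> ?R" for x y
    unfolding level_def[of y] using that level[of x] base_eq[OF that]
    by (intro Least_le) auto
  define A where "A c k = {x \<in> \<Union>\<U>. base x = c \<and> level x \<in> {k, Suc k}}" for c k
  define \<W> where "\<W> = range (\<lambda>(c, k). A c k)"
  have ref: "\<exists>W\<in>\<W>. U \<subseteq> W" if U: "U \<in> \<U>" for U
  proof (cases "U = {}")
    case True
    then show ?thesis unfolding \<W>_def by auto
  next
    case False
    \<comment> \<open>A point of \<open>U\<close> of least level determines the pair of levels containing \<open>U\<close>.\<close>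
    then obtain x where x: "x \<in> U" "\<And>y. y \<in> U \<Longrightarrow> level x \<le> level y"
      using arg_min_nat_lemma[of "\<lambda>x. x \<in> U" _ level] by blast
    have "y \<in> A (base x) (level x)" if y: "y \<in> U" for y
    proof -
      have "(x, y) \<in> ?R" using U x y unfolding close_rel_def by blast
      then show ?thesis
        using base_eq level_le[of x y] x(2)[OF y] y U unfolding A_def by force
    qed
    then show ?thesis unfolding \<W>_def by blast
  qed
  have "\<Union>\<W> = \<Union>\<U>" using ref unfolding \<W>_def A_def by blast
  moreover have "star_finite \<W>" unfolding star_finite_def
  proof
    fix W assume "W \<in> \<W>"
    then obtain c k where W: "W = A c k" unfolding \<W>_def by auto
    have "{V \<in> \<W>. W \<inter> V \<noteq> {}} \<subseteq> A c ` {..Suc k}"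
      unfolding \<W>_def W A_def by fastforce
    then show "finite {V \<in> \<W>. W \<inter> V \<noteq> {}}" by (rule finite_subset) simp
  qed
  moreover have "refines \<U> \<W>" using ref unfolding refines_def by blast
  moreover have "\<exists>m. \<exists>U\<in>\<U>. W \<subseteq> star_iter m U \<U>" if W: "W \<in> \<W>" "W \<noteq> {}" for W
  proof -
    obtain c k where Wck: "W = A c k" using W unfolding \<W>_def by auto
    obtain x where x: "x \<in> \<Union>\<U>" "base x = c" using W unfolding Wck A_def by blast
    have "(c, x) \<in> ?R\<^sup>*" using base[of x] x(2) by simp
    then have "c \<in> \<Union>\<U>"
    proof (cases rule: converse_rtranclE)
      case base
      then show ?thesis using x(1) by simp
    next
      case (step z)
      then show ?thesis unfolding close_rel_def by blast
    qed
    then obtain U where U: "U \<in> \<U>" "c \<in> U" by blast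
    have mono: "star_iter k U \<U> \<subseteq> star_iter (Suc k) U \<U>"
      by (rule star_iter_le_Suc) (use U in blast)
    have "W \<subseteq> star_iter (Suc k) U \<U>"
    proof
      fix y assume "y \<in> W"
      then have y: "base y = c" "level y = k \<or> level y = Suc k" unfolding Wck A_def by auto
      have "y \<in> star_iter (level y) U \<U>"
        unfolding star_iter_eq_Image using level[of y] U(2) y(1) by (intro ImageI[of c]) simp_all
      then show "y \<in> star_iter (Suc k) U \<U>" using y(2) mono by auto
    qed
    then show ?thesis using U(1) by blast
  qed
  ultimately show ?thesis by blast
qed

lemma star_finite_modification_level_cover:
  assumes \<mu>: "covering_uniformity X \<mu>" and \<U>: "\<U> \<in> \<mu>"
  shows "\<exists>\<W>\<in>star_finite_modification X \<mu>.
    \<forall>A\<in>\<W>. A \<noteq> {} \<longrightarrow> (\<exists>m. \<exists>U\<in>\<U>. A \<subseteq> star_iter m U \<U>)"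
proof -
  obtain \<W> where \<W>: "\<Union>\<W> = \<Union>\<U>" "star_finite \<W>" "refines \<U> \<W>"
      "\<forall>A\<in>\<W>. A \<noteq> {} \<longrightarrow> (\<exists>m. \<exists>U\<in>\<U>. A \<subseteq> star_iter m U \<U>)"
    using star_finite_level_cover[of \<U>] by (elim exE conjE)
  have "\<Union>\<W> = X" using \<W>(1) covering_uniformity_cover[OF \<mu> \<U>] by simp
  then have "\<W> \<in> \<mu>"
    using covering_uniformity_coarser[OF \<mu> \<U>] \<W>(3) unfolding refines_def by blast
  moreover have "refines \<W> \<W>" unfolding refines_def by blast
  ultimately have "\<W> \<in> star_finite_modification X \<mu>"
    using \<W>(2) star_finite_modification_iff[OF \<mu>] by blast
  then show ?thesis using \<W>(4) by (rule bexI[rotated])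
qed

section \<open>Filters\<close>

lemma filter_sets_nonempty: "F \<noteq> bot \<Longrightarrow> S \<in> filter_sets F \<Longrightarrow> S \<noteq> {}"
  unfolding filter_sets_def by (auto simp: trivial_limit_def)

lemma filter_sets_mono: "G \<le> F \<Longrightarrow> filter_sets F \<subseteq> filter_sets G"
  unfolding filter_sets_def le_filter_def by blast

lemma cluster_point_mono: "G \<le> F \<Longrightarrow> cluster_point T G x \<Longrightarrow> cluster_point T F x"
  using filter_sets_mono[of G F] unfolding cluster_point_def by (meson subsetD)

text \<open>In the order on filters \<open>G \<le> F\<close> means that \<open>G\<close> has more sets than \<open>F\<close>, so an ultrafilter is a
  minimal proper filter.\<close>

lemma exists_ultrafilter:
  fixes F :: "'a filter"
  assumes "F \<noteq> bot"
  obtains G where "G \<le> F" "G \<noteq> bot" "\<And>S. S \<in> filter_sets G \<or> - S \<in> filter_sets G"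
proof -
  define \<A> where "\<A> = {G. G \<le> F \<and> G \<noteq> bot}"
  let ?r = "relation_of (\<lambda>G H. H \<le> G) \<A>"
  have "\<exists>G\<in>\<A>. \<forall>H\<in>\<A>. H \<le> G \<longrightarrow> H = G"
  proof (rule predicate_Zorn)
    show "partial_order_on \<A> ?r"
      by (rule partial_order_on_relation_ofI) auto
    fix C assume C: "C \<in> Chains ?r"
    show "\<exists>u\<in>\<A>. \<forall>a\<in>C. u \<le> a"
    proof (cases "C = {}")
      case True
      then show ?thesis using assms unfolding \<A>_def by auto
    next
      case False
      have CA: "C \<subseteq> \<A>" using Chains_relation_of[OF C] .
      have "\<exists>z\<in>C. z \<le> inf x y" if "x \<in> C" "y \<in> C" for x y
        using that C unfolding Chains_def relation_of_def by auto
      then have "Inf C \<noteq> bot"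
        using CA False unfolding trivial_limit_def \<A>_def
        by (subst eventually_Inf_base) (auto simp: trivial_limit_def)
      moreover obtain H where "H \<in> C" "H \<le> F" using False CA unfolding \<A>_def by blast
      then have "Inf C \<le> F" by (rule Inf_lower2)
      ultimately have "Inf C \<in> \<A>" unfolding \<A>_def by simp
      then show ?thesis using Inf_lower by (intro bexI[of _ "Inf C"]) auto
    qed
  qed
  then obtain G where G: "G \<le> F" "G \<noteq> bot" and max\<A>: "\<forall>H\<in>\<A>. H \<le> G \<longrightarrow> H = G"
    unfolding \<A>_def by blast
  have max: "H = G" if "H \<le> G" "H \<noteq> bot" for H
    using max\<A> that order_trans[OF that(1) G(1)] unfolding \<A>_def by blast
  have "S \<in> filter_sets G \<or> - S \<in> filter_sets G" for S
  proof (cases "inf G (principal S) = bot")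
    case True
    then have "- S \<in> filter_sets G"
      unfolding trivial_limit_def filter_sets_def by (simp add: eventually_inf_principal)
    then show ?thesis ..
  next
    case False
    then have "inf G (principal S) = G" by (intro max) auto
    then have "S \<in> filter_sets G"
      unfolding filter_sets_def by (metis inf.absorb_iff1 le_principal mem_Collect_eq)
    then show ?thesis ..
  qed
  then show thesis using that G by blast
qed

lemma Inter_in_filter_sets:
  "finite \<F> \<Longrightarrow> (\<And>A. A \<in> \<F> \<Longrightarrow> f A \<in> filter_sets F) \<Longrightarrow> (\<Inter>A\<in>\<F>. f A) \<in> filter_sets F"
  unfolding filter_sets_def by (simp add: eventually_ball_finite)

text \<open>A finite union that meets every set of a filter has a member that does.\<close>

lemma filter_sets_meet_finite_Union:
  assumes fin: "finite \<F>" and meet: "\<And>S. S \<in> filter_sets F \<Longrightarrow> S \<inter> \<Union>\<F> \<noteq> {}"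
  shows "\<exists>A\<in>\<F>. \<forall>S\<in>filter_sets F. S \<inter> A \<noteq> {}"
proof (rule ccontr)
  assume "\<not> ?thesis"
  then obtain f where f: "\<And>A. A \<in> \<F> \<Longrightarrow> f A \<in> filter_sets F \<and> f A \<inter> A = {}" by metis
  then have "(\<Inter>A\<in>\<F>. f A) \<in> filter_sets F" using Inter_in_filter_sets[OF fin] by blast
  then have "(\<Inter>A\<in>\<F>. f A) \<inter> \<Union>\<F> \<noteq> {}" by (rule meet)
  then show False using f by blast
qed

lemma bourbaki_cauchy_imp_cofinally_bourbaki_cauchy:
  assumes "F \<noteq> bot" "bourbaki_cauchy_filter \<mu> F"
  shows "cofinally_bourbaki_cauchy_filter \<mu> F"
  unfolding cofinally_bourbaki_cauchy_filter_def
proof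
  fix \<U> assume "\<U> \<in> \<mu>"
  then obtain m U S where U: "U \<in> \<U>" and S: "S \<in> filter_sets F" "S \<subseteq> star_iter m U \<U>"
    using assms(2) unfolding bourbaki_cauchy_filter_def by blast
  have "S' \<inter> star_iter m U \<U> \<noteq> {}" if "S' \<in> filter_sets F" for S'
  proof -
    have "S' \<inter> S \<in> filter_sets F"
      using that S(1) unfolding filter_sets_def by (simp add: eventually_conj)
    then show ?thesis using filter_sets_nonempty[OF assms(1)] S(2) by blast
  qed
  then show "\<exists>m. \<exists>U\<in>\<U>. \<forall>S\<in>filter_sets F. S \<inter> star_iter m U \<U> \<noteq> {}" using U by blast
qed

lemma cofinally_bourbaki_cauchy_imp_cofinally_cauchy:
  assumes \<mu>: "covering_uniformity X \<mu>" and F: "cofinally_bourbaki_cauchy_filter \<mu> F"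
  shows "cofinally_cauchy_filter (star_finite_modification X \<mu>) F"
  unfolding cofinally_cauchy_filter_def
proof
  fix \<U> assume "\<U> \<in> star_finite_modification X \<mu>"
  then obtain \<W> where \<W>: "\<W> \<in> \<mu>" "star_finite \<W>" "refines \<W> \<U>"
    using star_finite_modification_iff[OF \<mu>] by blast
  obtain m U where U: "U \<in> \<W>" "\<forall>S\<in>filter_sets F. S \<inter> star_iter m U \<W> \<noteq> {}"
    using F[unfolded cofinally_bourbaki_cauchy_filter_def, rule_format, OF \<W>(1)]
    by (elim exE bexE)
  obtain \<F> where \<F>: "finite \<F>" "\<F> \<subseteq> \<W>" "star_iter m U \<W> \<subseteq> \<Union>\<F>"
    using star_iter_star_finite[OF \<W>(2) U(1), of m] by (elim exE conjE)
  have "S \<inter> \<Union>\<F> \<noteq> {}" if "S \<in> filter_sets F" for S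
    using U(2)[rule_format, OF that] \<F>(3) by blast
  then have "\<exists>A\<in>\<F>. \<forall>S\<in>filter_sets F. S \<inter> A \<noteq> {}"
    by (rule filter_sets_meet_finite_Union[OF \<F>(1)])
  then obtain A where A: "A \<in> \<W>" "\<forall>S\<in>filter_sets F. S \<inter> A \<noteq> {}" using \<F>(2) by blast
  obtain V where V: "V \<in> \<U>" "A \<subseteq> V" using \<W>(3) A(1) unfolding refines_def by blast
  have "S \<inter> V \<noteq> {}" if "S \<in> filter_sets F" for S
    using A(2)[rule_format, OF that] V(2) by blast
  then show "\<exists>U\<in>\<U>. \<forall>S\<in>filter_sets F. S \<inter> U \<noteq> {}" using V(1) by blast
qed

lemma cofinally_cauchy_ultrafilter_imp_cauchy:
  assumes G: "cofinally_cauchy_filter \<nu> G"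
    and ultra: "\<And>S. S \<in> filter_sets G \<or> - S \<in> filter_sets G"
  shows "cauchy_filter_wrt \<nu> G"
  unfolding cauchy_filter_wrt_def
proof
  fix \<U> assume "\<U> \<in> \<nu>"
  then obtain U where U: "U \<in> \<U>" "\<forall>S\<in>filter_sets G. S \<inter> U \<noteq> {}"
    using G unfolding cofinally_cauchy_filter_def by blast
  then have "- U \<notin> filter_sets G" by blast
  then have "U \<in> filter_sets G" using ultra by blast
  then show "\<exists>U\<in>\<U>. \<exists>S\<in>filter_sets G. S \<subseteq> U" using U(1) by blast
qed

lemma cauchy_imp_bourbaki_cauchy:
  assumes \<mu>: "covering_uniformity X \<mu>" and "F \<noteq> bot"
    and F: "cauchy_filter_wrt (star_finite_modification X \<mu>) F"
  shows "bourbaki_cauchy_filter \<mu> F"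
  unfolding bourbaki_cauchy_filter_def
proof
  fix \<U> assume \<U>: "\<U> \<in> \<mu>"
  obtain \<W> where \<W>: "\<W> \<in> star_finite_modification X \<mu>"
      "\<forall>A\<in>\<W>. A \<noteq> {} \<longrightarrow> (\<exists>m. \<exists>U\<in>\<U>. A \<subseteq> star_iter m U \<U>)"
    using star_finite_modification_level_cover[OF \<mu> \<U>] by (elim bexE)
  obtain A S where A: "A \<in> \<W>" "S \<in> filter_sets F" "S \<subseteq> A"
    using F \<W>(1) unfolding cauchy_filter_wrt_def by blast
  have "A \<noteq> {}" using filter_sets_nonempty[OF assms(2) A(2)] A(3) by blast
  then show "\<exists>m. \<exists>U\<in>\<U>. \<exists>S\<in>filter_sets F. S \<subseteq> star_iter m U \<U>"
    using \<W>(2)[rule_format, OF A(1)] A(2,3) by (meson order_trans)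
qed

lemma cofinally_cauchy_imp_cofinally_bourbaki_cauchy:
  assumes \<mu>: "covering_uniformity X \<mu>"
    and F: "cofinally_cauchy_filter (star_finite_modification X \<mu>) F"
  shows "cofinally_bourbaki_cauchy_filter \<mu> F"
  unfolding cofinally_bourbaki_cauchy_filter_def
proof
  fix \<U> assume \<U>: "\<U> \<in> \<mu>"
  obtain \<W> where \<W>: "\<W> \<in> star_finite_modification X \<mu>"
      "\<forall>A\<in>\<W>. A \<noteq> {} \<longrightarrow> (\<exists>m. \<exists>U\<in>\<U>. A \<subseteq> star_iter m U \<U>)"
    using star_finite_modification_level_cover[OF \<mu> \<U>] by (elim bexE)
  obtain A where A: "A \<in> \<W>" "\<forall>S\<in>filter_sets F. S \<inter> A \<noteq> {}"
    using F \<W>(1) unfolding cofinally_cauchy_filter_def by blast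
  have "UNIV \<in> filter_sets F" unfolding filter_sets_def by simp
  then have "A \<noteq> {}" using A(2) by blast
  then obtain m U where "U \<in> \<U>" "A \<subseteq> star_iter m U \<U>"
    using \<W>(2)[rule_format, OF A(1)] by blast
  then show "\<exists>m. \<exists>U\<in>\<U>. \<forall>S\<in>filter_sets F. S \<inter> star_iter m U \<U> \<noteq> {}" using A(2) by blast
qed

section \<open>Completeness\<close>

lemma cofinally_bourbaki_complete_iff:
  assumes "hausdorff_uniform_space X \<mu>"
  shows "cofinally_bourbaki_complete_unif X \<mu> \<longleftrightarrow>
    cofinally_complete_unif X (star_finite_modification X \<mu>)"
proof -
  have \<mu>: "covering_uniformity X \<mu>" using assms unfolding hausdorff_uniform_space_def by blast
  have "cofinally_bourbaki_cauchy_filter \<mu> F \<longleftrightarrow>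
      cofinally_cauchy_filter (star_finite_modification X \<mu>) F" for F
    using cofinally_bourbaki_cauchy_imp_cofinally_cauchy[OF \<mu>]
      cofinally_cauchy_imp_cofinally_bourbaki_cauchy[OF \<mu>] by blast
  then show ?thesis
    unfolding cofinally_bourbaki_complete_unif_def cofinally_complete_unif_def
      unif_topology_star_finite_modification[OF assms] by simp
qed

lemma bourbaki_complete_iff:
  assumes "hausdorff_uniform_space X \<mu>"
  shows "bourbaki_complete_unif X \<mu> \<longleftrightarrow> complete_unif X (star_finite_modification X \<mu>)"
proof
  have \<mu>: "covering_uniformity X \<mu>" using assms unfolding hausdorff_uniform_space_def by blast
  note topo = unif_topology_star_finite_modification[OF assms]
  show "complete_unif X (star_finite_modification X \<mu>)" if "bourbaki_complete_unif X \<mu>"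
    using that cauchy_imp_bourbaki_cauchy[OF \<mu>]
    unfolding bourbaki_complete_unif_def complete_unif_def topo filter_on_def by blast
  assume compl: "complete_unif X (star_finite_modification X \<mu>)"
  show "bourbaki_complete_unif X \<mu>"
    unfolding bourbaki_complete_unif_def
  proof (intro allI impI)
    fix F assume "filter_on X F \<and> bourbaki_cauchy_filter \<mu> F"
    then have F: "F \<noteq> bot" "F \<le> principal X" "bourbaki_cauchy_filter \<mu> F"
      unfolding filter_on_def by auto
    obtain G where G: "G \<le> F" "G \<noteq> bot" "\<And>S. S \<in> filter_sets G \<or> - S \<in> filter_sets G"
      using exists_ultrafilter[OF F(1)] by blast
    have "bourbaki_cauchy_filter \<mu> G"
      using F(3) filter_sets_mono[OF G(1)] unfolding bourbaki_cauchy_filter_def by blast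
    then have "cofinally_cauchy_filter (star_finite_modification X \<mu>) G"
      using bourbaki_cauchy_imp_cofinally_bourbaki_cauchy[OF G(2)]
        cofinally_bourbaki_cauchy_imp_cofinally_cauchy[OF \<mu>] by blast
    then have "cauchy_filter_wrt (star_finite_modification X \<mu>) G"
      using cofinally_cauchy_ultrafilter_imp_cauchy G(3) by blast
    moreover have "filter_on X G" using G F(2) unfolding filter_on_def by auto
    ultimately obtain x where "cluster_point (unif_topology X \<mu>) G x"
      using compl unfolding complete_unif_def topo by blast
    then show "\<exists>x. cluster_point (unif_topology X \<mu>) F x"
      using cluster_point_mono[OF G(1)] by blast
  qed
qed

theorem theorem1p2p11:
  fixes X :: "'a set" and \<mu> :: "'a set set set"
  assumes "hausdorff_uniform_space X \<mu>"
  shows "(bourbaki_complete_unif X \<mu> \<longleftrightarrow> complete_unif X (star_finite_modification X \<mu>))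
    \<and> (cofinally_bourbaki_complete_unif X \<mu>
         \<longleftrightarrow> cofinally_complete_unif X (star_finite_modification X \<mu>))
    \<and> ((\<exists>\<B>. uniformity_base \<mu> \<B> \<and> (\<forall>\<U>\<in>\<B>. star_finite \<U>)) \<longrightarrow>
         (complete_unif X \<mu> \<longleftrightarrow> bourbaki_complete_unif X \<mu>)
       \<and> (cofinally_complete_unif X \<mu> \<longleftrightarrow> cofinally_bourbaki_complete_unif X \<mu>))"
proof -
  have "covering_uniformity X \<mu>" using assms unfolding hausdorff_uniform_space_def by blast
  then have "star_finite_modification X \<mu> = \<mu>"
    if "uniformity_base \<mu> \<B>" "\<forall>\<U>\<in>\<B>. star_finite \<U>" for \<B>
    using star_finite_modification_eq that by blast
  then show ?thesis
    using bourbaki_complete_iff[OF assms] cofinally_bourbaki_complete_iff[OF assms] by metis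
qed

end
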